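(* Let $\mathcal{I}$ be the collection of feasible assignments, i.e. of all subsets $S\subseteq\mathcal{E}$ such that $|S\cap S_n|\le 1$ for $n=1,\dots,N$. Then the pair $(\mathcal{E},\mathcal{I})$ is a matroid.
   Context: There are $N$ agents, each with a budget of exactly one search, and $K$ locations. (This arises from a problem with $M$ agents with budgets $N_m$, $N=\sum_m N_m$, by splitting each agent into unit-budget agents with unique identities.) $\mathcal{E}\subseteq\{1,\dots,N\}\times\{1,\dots,K\}$ is the set of accessibility pairs: $(n,k)\in\mathcal{E}$ iff agent $n$ can search location $k$. For each agent $n$, $S_n=\{(n,k) : k\in\{1,\dots,K\},\ (n,k)\in\mathcal{E}\}$ is the set of accessibility pairs of agent $n$; the sets $S_1,\dots,S_N$ are pairwise disjoint with union $\mathcal{E}$. In the pair $(\mathcal{E},\mathcal{I})$, $\mathcal{E}$ is the ground set and $\mathcal{I}$ is the family of independent sets. *)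

theory Defs
  imports Main
begin

text \<open>Finite matroids, given by a ground set and a family of independent sets.\<close>

locale matroid =
  fixes E :: "'a set" and I :: "'a set set"
  assumes finite_ground: "finite E"
    and indep_subset_ground: "X \<in> I \<Longrightarrow> X \<subseteq> E"
    and indep_empty: "{} \<in> I"
    and indep_hereditary: "X \<in> I \<Longrightarrow> Y \<subseteq> X \<Longrightarrow> Y \<in> I"
    and indep_augment:
      "X \<in> I \<Longrightarrow> Y \<in> I \<Longrightarrow> card X < card Y \<Longrightarrow> \<exists>y \<in> Y - X. insert y X \<in> I"

text \<open>
  A pair \<open>(n, k)\<close> means that agent \<open>n\<close> can search location \<open>k\<close>.
  The set \<open>S\<^sub>n\<close> of accessibility pairs of agent \<open>n\<close>:
\<close>

definition agent_pairs :: "nat \<Rightarrow> (nat \<times> nat) set \<Rightarrow> nat \<Rightarrow> (nat \<times> nat) set" where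
  "agent_pairs K E n = {(n, k) | k. k \<in> {1..K} \<and> (n, k) \<in> E}"

definition feasible_assignments ::
    "nat \<Rightarrow> nat \<Rightarrow> (nat \<times> nat) set \<Rightarrow> (nat \<times> nat) set set" where
  "feasible_assignments N K E =
     {S. S \<subseteq> E \<and> (\<forall>n \<in> {1..N}. card (S \<inter> agent_pairs K E n) \<le> 1)}"

end

theory Submission
  imports Defs
begin

text \<open>
  Every pair in the ground set belongs to exactly one agent, namely its first component.  So the
  condition that an assignment uses each agent at most once says that \<open>fst\<close> is injective on it
  (lemma \<open>feasible_assignments_iff_inj_on_fst\<close>), and the feasible assignments are the partial
  transversals of the fibres of \<open>fst\<close>: a partition matroid.  Injectivity passes to subsets.  For
  augmentation, a feasible assignment has as many pairs as it uses agents, so the larger of two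
  assignments uses an agent that the smaller one leaves idle, and the pair of that agent can be added.
\<close>

text \<open>
  The cardinality bound constrains only the agents \<open>1, \<dots>, N\<close> and the locations \<open>1, \<dots>, K\<close>.  It
  amounts to injectivity because \<open>E\<close> has no pairs outside these ranges, and because \<open>E\<close> is finite,
  so that the cardinality of an intersection never takes the value \<open>0\<close> assigned to infinite sets.
\<close>

lemma feasible_assignments_iff_inj_on_fst:
  assumes E: "E \<subseteq> {1..N} \<times> {1..K}"
  shows "S \<in> feasible_assignments N K E \<longleftrightarrow> S \<subseteq> E \<and> inj_on fst S"
proof (cases "S \<subseteq> E")
  case True
  have fibre: "S \<inter> agent_pairs K E n = {p \<in> S. fst p = n}" for n
    using True subset_trans[OF True E] by (auto simp: agent_pairs_def subset_iff)
  have "finite S"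
    using True E by (meson finite_SigmaI finite_atLeastAtMost finite_subset)
  then have at_most_one: "card (S \<inter> agent_pairs K E n) \<le> 1 \<longleftrightarrow>
      (\<forall>p \<in> S. \<forall>q \<in> S. fst p = n \<longrightarrow> fst q = n \<longrightarrow> p = q)" for n
    unfolding fibre by (simp add: card_le_Suc0_iff_eq) force
  have "fst p \<in> {1..N}" if "p \<in> S" for p
    using that True E by auto
  then show ?thesis
    using True unfolding feasible_assignments_def mem_Collect_eq at_most_one inj_on_def by metis
qed (simp add: feasible_assignments_def)

lemma ex_insert_inj_on_of_card_less:
  assumes "finite A" "inj_on f A" "inj_on f B" "card A < card B"
  shows "\<exists>b \<in> B - A. inj_on f (insert b A)"
proof -
  have "card (f ` A) < card (f ` B)"
    using assms by (simp add: card_image)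
  then have "\<not> f ` B \<subseteq> f ` A"
    using \<open>finite A\<close> by (meson card_mono finite_imageI not_less)
  then obtain b where "b \<in> B" "f b \<notin> f ` A"
    by blast
  then show ?thesis
    using \<open>inj_on f A\<close> by (intro bexI[of _ b]) auto
qed

theorem lemmaV2:
  fixes N K :: nat and E :: "(nat \<times> nat) set"
  assumes "E \<subseteq> {1..N} \<times> {1..K}"
  shows "matroid E (feasible_assignments N K E)"
proof -
  note feasible_iff = feasible_assignments_iff_inj_on_fst[OF assms]
  show ?thesis
  proof
    show fin: "finite E"
      using assms by (meson finite_SigmaI finite_atLeastAtMost finite_subset)
    show "{} \<in> feasible_assignments N K E"
      by (simp add: feasible_iff)
    show "X \<subseteq> E" if "X \<in> feasible_assignments N K E" for X
      using that by (simp add: feasible_iff)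
    show "Y \<in> feasible_assignments N K E"
      if "X \<in> feasible_assignments N K E" "Y \<subseteq> X" for X Y
      using that by (auto simp: feasible_iff intro: inj_on_subset)
    show "\<exists>y \<in> Y - X. insert y X \<in> feasible_assignments N K E"
      if X: "X \<in> feasible_assignments N K E" and Y: "Y \<in> feasible_assignments N K E"
        and less: "card X < card Y" for X Y
    proof -
      have XY: "X \<subseteq> E" "inj_on fst X" "Y \<subseteq> E" "inj_on fst Y"
        using X Y by (simp_all add: feasible_iff)
      then obtain y where "y \<in> Y - X" "inj_on fst (insert y X)"
        using ex_insert_inj_on_of_card_less[of X fst Y] less fin finite_subset by blast
      with XY show ?thesis
        unfolding feasible_iff by blast
    qed
  qed
qed

end
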